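(* Let $n\geq1$ be an integer, $\gamma\in(0,n)$, and let $q_1,q_2$ be real numbers with $\min\{q_1,q_2\}>0$. If $q_1q_2>1$, then the system $$\begin{cases}u(x)=\displaystyle\int_{\mathbb{R}^n}\frac{v^{q_2}(y)}{|x-y|^{n-\gamma}|y|^{\gamma}}\,dy,\\[2mm] v(x)=\displaystyle\int_{\mathbb{R}^n}\frac{u^{q_1}(y)}{|x-y|^{n-\gamma}|x|^{\gamma}}\,dy\end{cases}$$ has no positive super solution $(u,v)$ such that $u$ and $v$ are radially symmetric and decreasing (in $|x|$) and $u,v\in L^\infty_{loc}(\mathbb{R}^n\setminus\{0\})$.
   Context: A pair of functions $(u,v)$, positive in $\mathbb{R}^n\setminus\{0\}$, is called a positive super solution of the system if there are positive constants $c_1,c_2$ such that for $x\in\mathbb{R}^n\setminus\{0\}$ $$u(x)\geq c_1\int_{\mathbb{R}^n}\frac{v^{q_2}(y)}{|x-y|^{n-\gamma}|y|^{\gamma}}\,dy,\qquad v(x)\geq c_2\int_{\mathbb{R}^n}\frac{u^{q_1}(y)}{|x-y|^{n-\gamma}|x|^{\gamma}}\,dy.$$ $L^\infty_{loc}(\mathbb{R}^n\setminus\{0\})$ is the set of measurable functions bounded on each compact subset of $\mathbb{R}^n\setminus\{0\}$. *)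

theory Defs
  imports "HOL-Analysis.Analysis"
begin

text \<open>
  Functions on $R^n$ without the origin are total functions on \<^typ>\<open>real^'n\<close> whose value at
  the origin is irrelevant. The right-hand sides are Lebesgue integrals with values in
  \<^typ>\<open>ennreal\<close>, so a divergent integral is infinite and cannot be bounded by a function value.
  Division by zero affects the integrands only on a null set.
\<close>

definition rhs_u :: "real \<Rightarrow> real \<Rightarrow> (real^'n \<Rightarrow> real) \<Rightarrow> real^'n \<Rightarrow> ennreal" where
  "rhs_u \<gamma> q\<^sub>2 v x =
     (\<integral>\<^sup>+ y. ennreal (v y powr q\<^sub>2 / (norm (x - y) powr (real CARD('n) - \<gamma>) * norm y powr \<gamma>))
        \<partial>lebesgue)"

text \<open>Here the weight is \<open>norm x powr \<gamma>\<close>, not \<open>norm y powr \<gamma>\<close>; the system is not symmetric.\<close>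

definition rhs_v :: "real \<Rightarrow> real \<Rightarrow> (real^'n \<Rightarrow> real) \<Rightarrow> real^'n \<Rightarrow> ennreal" where
  "rhs_v \<gamma> q\<^sub>1 u x =
     (\<integral>\<^sup>+ y. ennreal (u y powr q\<^sub>1 / (norm (x - y) powr (real CARD('n) - \<gamma>) * norm x powr \<gamma>))
        \<partial>lebesgue)"

definition positive_super_solution ::
    "real \<Rightarrow> real \<Rightarrow> real \<Rightarrow> (real^'n \<Rightarrow> real) \<Rightarrow> (real^'n \<Rightarrow> real) \<Rightarrow> bool" where
  "positive_super_solution \<gamma> q\<^sub>1 q\<^sub>2 u v \<longleftrightarrow>
     (\<forall>x. x \<noteq> 0 \<longrightarrow> u x > 0 \<and> v x > 0) \<and>
     (\<exists>c\<^sub>1 c\<^sub>2 :: real. c\<^sub>1 > 0 \<and> c\<^sub>2 > 0 \<and>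
        (\<forall>x. x \<noteq> 0 \<longrightarrow>
           ennreal (u x) \<ge> ennreal c\<^sub>1 * rhs_u \<gamma> q\<^sub>2 v x \<and>
           ennreal (v x) \<ge> ennreal c\<^sub>2 * rhs_v \<gamma> q\<^sub>1 u x))"

definition Linf_loc_punctured :: "(real^'n \<Rightarrow> real) set" where
  "Linf_loc_punctured =
     {f. f \<in> borel_measurable (lebesgue_on (- {0})) \<and>
         (\<forall>K. compact K \<and> K \<subseteq> - {0} \<longrightarrow> bounded (f ` K))}"

definition radially_symmetric :: "(real^'n \<Rightarrow> real) \<Rightarrow> bool" where
  "radially_symmetric f \<longleftrightarrow>
     (\<forall>x y. x \<noteq> 0 \<and> y \<noteq> 0 \<and> norm x = norm y \<longrightarrow> f x = f y)"

text \<open>Decreasing is meant in the weak sense, so the nonexistence claim covers strict decrease.\<close>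

definition radially_decreasing :: "(real^'n \<Rightarrow> real) \<Rightarrow> bool" where
  "radially_decreasing f \<longleftrightarrow>
     (\<forall>x y. x \<noteq> 0 \<and> y \<noteq> 0 \<and> norm x < norm y \<longrightarrow> f y \<le> f x)"

end

theory Submission
  imports Defs
begin

text \<open>
  Averaging each inequality over the ball of radius \<open>|x|\<close>, where the monotone functions are at
  least their values at \<open>x\<close>, gives \<open>u \<ge> a * v powr q\<^sub>2\<close> and \<open>v \<ge> b * u powr q\<^sub>1\<close> pointwise; as \<open>q\<^sub>1 * q\<^sub>2 > 1\<close>,
  \<open>u\<close> is bounded. On the other hand \<open>v\<close> is bounded below on the punctured unit ball, so every
  dyadic annulus between \<open>|x|\<close> and \<open>1\<close> contributes at least a fixed amount to the integral
  bounding \<open>u(x)\<close>, and \<open>u\<close> blows up at the origin.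
\<close>

text \<open>By disjointness at most one summand of the step function
  \<open>\<Sum>i\<in>I. c i * indicator (A i) y\<close> is nonzero at each \<open>y\<close>, so it
  lies below \<open>f\<close> pointwise.\<close>

lemma sum_emeasure_le_nn_integral:
  fixes c :: "'i \<Rightarrow> ennreal"
  assumes "finite I" "disjoint_family_on A I"
    and A: "\<And>i. i \<in> I \<Longrightarrow> A i \<in> sets M"
    and le: "\<And>i y. i \<in> I \<Longrightarrow> y \<in> A i \<Longrightarrow> c i \<le> f y"
  shows "(\<Sum>i\<in>I. c i * emeasure M (A i)) \<le> (\<integral>\<^sup>+ y. f y \<partial>M)"
proof -
  have "(\<Sum>i\<in>I. c i * emeasure M (A i)) = (\<Sum>i\<in>I. \<integral>\<^sup>+ y. c i * indicator (A i) y \<partial>M)"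
    using A by (intro sum.cong) (auto simp: nn_integral_cmult_indicator)
  also have "\<dots> = (\<integral>\<^sup>+ y. (\<Sum>i\<in>I. c i * indicator (A i) y) \<partial>M)"
    using A by (intro nn_integral_sum[symmetric]) auto
  also have "\<dots> \<le> (\<integral>\<^sup>+ y. f y \<partial>M)"
  proof (intro nn_integral_mono)
    fix y
    show "(\<Sum>i\<in>I. c i * indicator (A i) y) \<le> f y"
    proof (cases "\<exists>j\<in>I. y \<in> A j")
      case True
      then obtain j where j: "j \<in> I" "y \<in> A j" by blast
      then have "indicator (A i) y = (if i = j then 1 else 0 :: ennreal)" if "i \<in> I" for i
        using that assms(2) by (auto simp: disjoint_family_on_def indicator_def)
      then have "(\<Sum>i\<in>I. c i * indicator (A i) y) = (\<Sum>i\<in>I. if i = j then c i else 0)"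
        by (intro sum.cong) auto
      also have "\<dots> = c j" using j assms(1) by simp
      finally show ?thesis using le[OF j] by simp
    next
      case False
      then have "(\<Sum>i\<in>I. c i * indicator (A i) y) = 0"
        by (intro sum.neutral) (auto simp: indicator_def)
      then show ?thesis by simp
    qed
  qed
  finally show ?thesis .
qed

text \<open>Both \<open>norm (x - y)\<close> and \<open>norm z\<close> are at most
  \<open>2 * R\<close>, and the exponents \<open>d - \<gamma>\<close> and \<open>\<gamma>\<close>
  add up to \<open>d\<close>. The free point \<open>z\<close> covers both weights of the system:
  \<open>z = y\<close> for \<open>u\<close>, \<open>z = x\<close> for \<open>v\<close>.\<close>

lemma kernel_lower_bound:
  fixes x y z :: "'a::real_normed_vector"
  assumes "0 < \<gamma>" "\<gamma> < d" "x \<noteq> y" "z \<noteq> 0" "norm x \<le> R" "norm y \<le> R" "norm z \<le> R"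
    and "0 \<le> a" "a \<le> b"
  shows "a / (2 * R) powr d \<le> b / (norm (x - y) powr (d - \<gamma>) * norm z powr \<gamma>)"
proof (rule frac_le)
  have "norm (x - y) \<le> 2 * R"
    using norm_triangle_ineq4[of x y] assms by linarith
  moreover have "norm z \<le> 2 * R"
    using assms norm_ge_zero[of x] by linarith
  ultimately have "norm (x - y) powr (d - \<gamma>) * norm z powr \<gamma> \<le> (2 * R) powr (d - \<gamma>) * (2 * R) powr \<gamma>"
    using assms by (intro mult_mono powr_mono2) auto
  then show "norm (x - y) powr (d - \<gamma>) * norm z powr \<gamma> \<le> (2 * R) powr d"
    by (simp flip: powr_add)
  show "0 < norm (x - y) powr (d - \<gamma>) * norm z powr \<gamma>"
    using assms by simp
qed (use assms in auto)

lemma emeasure_lebesgue_ball: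
  fixes z :: "real^'n"
  assumes "0 \<le> r"
  shows "emeasure lebesgue (ball z r) = ennreal (unit_ball_vol (real CARD('n)) * r ^ CARD('n))"
  using emeasure_ball[OF assms, of z] by simp

text \<open>On the ball of radius \<open>norm x\<close> the kernel is at least
  \<open>(2 * norm x)\<close> to the power -n, while the volume grows like the n-th power of
  \<open>norm x\<close>; the radius cancels. The map \<open>w\<close> selects the weight: the
  identity gives \<open>rhs_u\<close>, the constant \<open>x\<close> gives
  \<open>rhs_v\<close>.\<close>

lemma rhs_lower_bound:
  fixes f :: "real^'n \<Rightarrow> real" and w :: "real^'n \<Rightarrow> real^'n"
  assumes "0 < \<gamma>" "\<gamma> < real CARD('n)" "0 < q" "x \<noteq> 0"
    and pos: "\<And>y. y \<noteq> 0 \<Longrightarrow> 0 < f y"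
    and dec: "radially_decreasing f"
    and w: "\<And>y. y \<noteq> 0 \<Longrightarrow> norm y < norm x \<Longrightarrow> w y \<noteq> 0 \<and> norm (w y) \<le> norm x"
  shows "ennreal (unit_ball_vol (real CARD('n)) / 2 ^ CARD('n) * f x powr q)
    \<le> (\<integral>\<^sup>+ y. ennreal (f y powr q / (norm (x - y) powr (real CARD('n) - \<gamma>) * norm (w y) powr \<gamma>))
         \<partial>lebesgue)" (is "_ \<le> integral\<^sup>N _ ?g")
proof -
  let ?n = "CARD('n)" and ?r = "norm x"
  have r: "0 < ?r" using assms by simp
  have le: "ennreal (f x powr q / (2 * ?r) powr ?n) \<le> ?g y" if "y \<in> ball 0 ?r - {0}" for y
  proof (intro ennreal_leI kernel_lower_bound)
    show "f x powr q \<le> f y powr q"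
      using that assms less_imp_le[OF pos[of x]] dec
      by (intro powr_mono2) (auto simp: radially_decreasing_def)
  qed (use that assms w[of y] in auto)
  \<comment> \<open>Positivity and monotonicity say nothing about the value at the origin, so it is
    cut out as a null set.\<close>
  have "emeasure lebesgue (ball (0::real^'n) ?r - {0}) = emeasure lebesgue (ball (0::real^'n) ?r)"
    by (intro emeasure_Diff_null_set) (auto simp: null_sets_def)
  then have vol: "emeasure lebesgue (ball (0::real^'n) ?r - {0})
      = ennreal (unit_ball_vol (real ?n) * ?r ^ ?n)"
    using emeasure_lebesgue_ball[of ?r "0::real^'n"] by simp
  have "unit_ball_vol (real ?n) / 2 ^ ?n * f x powr q
      = f x powr q / (2 * ?r) powr ?n * (unit_ball_vol (real ?n) * ?r ^ ?n)"
    using r by (simp add: powr_realpow power_mult_distrib field_simps)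
  then have "ennreal (unit_ball_vol (real ?n) / 2 ^ ?n * f x powr q)
      = ennreal (f x powr q / (2 * ?r) powr ?n) * emeasure lebesgue (ball (0::real^'n) ?r - {0})"
    by (simp add: vol flip: ennreal_mult)
  also have "\<dots> \<le> integral\<^sup>N lebesgue ?g"
    using sum_emeasure_le_nn_integral[of "{()}" "\<lambda>_. ball (0::real^'n) ?r - {0}" lebesgue
        "\<lambda>_. ennreal (f x powr q / (2 * ?r) powr ?n)" ?g] le
    by (simp add: disjoint_family_on_def)
  finally show ?thesis .
qed

text \<open>At points beyond \<open>norm x\<close> the kernel is of order at least
  \<open>norm y\<close> to the power -n, whose integral over a dyadic annulus does not depend on the
  scale. Growth linear in \<open>N\<close> is logarithmic growth in
  \<open>1 / norm x\<close>.\<close>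

lemma rhs_u_log_growth:
  fixes v :: "real^'n \<Rightarrow> real"
  assumes "0 < \<gamma>" "\<gamma> < real CARD('n)" "0 < q" "x \<noteq> 0" "norm x \<le> (1/2) ^ N" "norm e = 1"
    and pos: "\<And>y. y \<noteq> 0 \<Longrightarrow> 0 < v y"
    and dec: "radially_decreasing v"
  shows "ennreal (real N * (v e powr q * unit_ball_vol (real CARD('n)) / 8 ^ CARD('n)))
    \<le> rhs_u \<gamma> q v x"
proof -
  let ?n = "CARD('n)" and ?R = "\<lambda>k::nat. (1/2::real) ^ k"
  \<comment> \<open>Instead of the full annulus \<open>R/2 < |y| < R\<close> a ball contained in it is used.\<close>
  let ?B = "\<lambda>k. ball ((3/4 * ?R k) *\<^sub>R e) (?R k / 4)"
  let ?g = "\<lambda>y. ennreal (v y powr q / (norm (x - y) powr (real ?n - \<gamma>) * norm y powr \<gamma>))"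
  have B: "?R (Suc k) < norm y \<and> norm y < ?R k" if "y \<in> ?B k" for y k
  proof -
    have "\<bar>norm y - norm ((3/4 * ?R k) *\<^sub>R e)\<bar> \<le> norm (y - (3/4 * ?R k) *\<^sub>R e)"
      by (rule norm_triangle_ineq3)
    moreover have "norm (y - (3/4 * ?R k) *\<^sub>R e) < ?R k / 4"
      using that by (simp add: dist_norm norm_minus_commute)
    moreover have "norm ((3/4 * ?R k) *\<^sub>R e) = 3/4 * ?R k"
      using assms by simp
    ultimately show ?thesis by (simp only: power_Suc) linarith
  qed
  have disj: "disjoint_family_on ?B {..<N}"
  proof -
    have "False" if "y \<in> ?B j" "y \<in> ?B k" "j < k" for y j k
    proof -
      have "?R k \<le> ?R (Suc j)" using that by (intro power_decreasing) auto
      then show False using B[OF that(1)] B[OF that(2)] by linarith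
    qed
    then show ?thesis
      unfolding disjoint_family_on_def by (metis disjoint_iff linorder_neqE_nat)
  qed
  have le: "ennreal (v e powr q / (2 * ?R k) powr ?n) \<le> ?g y" if "k \<in> {..<N}" "y \<in> ?B k" for k y
  proof -
    have y: "?R (Suc k) < norm y" "norm y < ?R k" using B[OF that(2)] by auto
    \<comment> \<open>As \<open>k < N\<close>, the whole annulus lies outside the sphere through
      \<open>x\<close>; hence \<open>x\<close> differs from \<open>y\<close> and also has norm at
      most \<open>?R k\<close>, as the kernel bound requires.\<close>
    have "?R N \<le> ?R (Suc k)" using that by (intro power_decreasing) auto
    then have xy: "norm x < norm y" using y assms by linarith
    have "?R k \<le> 1" by (intro power_le_one) auto
    then have "norm y < norm e" using y assms by linarith
    moreover have "e \<noteq> 0" "y \<noteq> 0" using assms xy by auto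
    ultimately have "v e \<le> v y" "0 < v e"
      using dec pos by (auto simp: radially_decreasing_def)
    then show ?thesis
      using y xy assms by (intro ennreal_leI kernel_lower_bound powr_mono2) auto
  qed
  \<comment> \<open>The radius \<open>?R k / 4\<close> of the ball over the length
    \<open>2 * ?R k\<close> in the kernel bound is 1/8 for every \<open>k\<close>.\<close>
  have term_eq: "ennreal (v e powr q / (2 * ?R k) powr ?n) * emeasure lebesgue (?B k)
      = ennreal (v e powr q * unit_ball_vol (real ?n) / 8 ^ ?n)" for k
  proof -
    have pow8: "(2::real) ^ ?n * 4 ^ ?n = 8 ^ ?n"
      by (simp flip: power_mult_distrib)
    have "v e powr q / (2 * ?R k) powr ?n * (unit_ball_vol (real ?n) * (?R k / 4) ^ ?n)
        = v e powr q * unit_ball_vol (real ?n) * ((?R k / 4) / (2 * ?R k)) ^ ?n"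
      using pow8 by (simp add: powr_realpow power_divide)
    also have "(?R k / 4) / (2 * ?R k) = 1/8"
      by simp
    finally have eq: "v e powr q / (2 * ?R k) powr ?n * (unit_ball_vol (real ?n) * (?R k / 4) ^ ?n)
        = v e powr q * unit_ball_vol (real ?n) / 8 ^ ?n"
      by (simp add: power_divide)
    have "emeasure lebesgue (?B k) = ennreal (unit_ball_vol (real ?n) * (?R k / 4) ^ ?n)"
      by (intro emeasure_lebesgue_ball) simp
    then show ?thesis
      unfolding eq[symmetric] by (simp only:) (intro ennreal_mult[symmetric]; simp)
  qed
  have "ennreal (real N * (v e powr q * unit_ball_vol (real ?n) / 8 ^ ?n))
      = (\<Sum>k<N. ennreal (v e powr q / (2 * ?R k) powr ?n) * emeasure lebesgue (?B k))"
    unfolding term_eq by (simp add: ennreal_of_nat_eq_real_of_nat flip: ennreal_mult)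
  also have "\<dots> \<le> integral\<^sup>N lebesgue ?g"
    using disj le by (intro sum_emeasure_le_nn_integral) auto
  finally show ?thesis unfolding rhs_u_def .
qed

theorem theorem1p6:
  fixes \<gamma> q\<^sub>1 q\<^sub>2 :: real
  assumes "0 < \<gamma>" and "\<gamma> < real CARD('n)"
    and "min q\<^sub>1 q\<^sub>2 > 0"
    and "q\<^sub>1 * q\<^sub>2 > 1"
  shows "\<not> (\<exists>u v :: real^'n \<Rightarrow> real.
            positive_super_solution \<gamma> q\<^sub>1 q\<^sub>2 u v \<and>
            radially_symmetric u \<and> radially_symmetric v \<and>
            radially_decreasing u \<and> radially_decreasing v \<and>
            u \<in> Linf_loc_punctured \<and> v \<in> Linf_loc_punctured)"
proof
  assume "\<exists>u v :: real^'n \<Rightarrow> real.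
            positive_super_solution \<gamma> q\<^sub>1 q\<^sub>2 u v \<and>
            radially_symmetric u \<and> radially_symmetric v \<and>
            radially_decreasing u \<and> radially_decreasing v \<and>
            u \<in> Linf_loc_punctured \<and> v \<in> Linf_loc_punctured"
  then obtain u v :: "real^'n \<Rightarrow> real" and c\<^sub>1 c\<^sub>2 :: real
    where pos: "\<And>x. x \<noteq> 0 \<Longrightarrow> 0 < u x" "\<And>x. x \<noteq> 0 \<Longrightarrow> 0 < v x"
      and dec: "radially_decreasing u" "radially_decreasing v"
      and c: "0 < c\<^sub>1" "0 < c\<^sub>2"
      and U: "\<And>x. x \<noteq> 0 \<Longrightarrow> ennreal c\<^sub>1 * rhs_u \<gamma> q\<^sub>2 v x \<le> ennreal (u x)"
      and V: "\<And>x. x \<noteq> 0 \<Longrightarrow> ennreal c\<^sub>2 * rhs_v \<gamma> q\<^sub>1 u x \<le> ennreal (v x)"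
    unfolding positive_super_solution_def by blast
  have q: "0 < q\<^sub>1" "0 < q\<^sub>2" using assms by auto
  \<comment> \<open>Passage from \<open>ennreal\<close> back to real inequalities: only a finite
    lower bound \<open>t\<close> of the integral \<open>F\<close> is used, so \<open>F\<close> need
    not be known to be finite.\<close>
  have mult_bound: "a * t \<le> s" if "ennreal a * F \<le> ennreal s" "ennreal t \<le> F" "0 < a" "0 \<le> t" "0 < s"
    for a t s :: real and F
  proof -
    have "ennreal (a * t) = ennreal a * ennreal t" using that by (simp add: ennreal_mult)
    also have "\<dots> \<le> ennreal s" using that by (meson mult_left_mono order_trans zero_le)
    finally show ?thesis using that by simp
  qed
  define K where "K = unit_ball_vol (real CARD('n)) / 2 ^ CARD('n)"
  have K: "0 < K" by (simp add: K_def)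
  have u_ge: "c\<^sub>1 * (K * v x powr q\<^sub>2) \<le> u x" if "x \<noteq> 0" for x
    using U[OF that] rhs_lower_bound[of \<gamma> q\<^sub>2 x v "\<lambda>y. y"] that assms q pos dec c K
    unfolding K_def rhs_u_def by (intro mult_bound) auto
  have v_ge: "c\<^sub>2 * (K * u x powr q\<^sub>1) \<le> v x" if "x \<noteq> 0" for x
    using V[OF that] rhs_lower_bound[of \<gamma> q\<^sub>1 x u "\<lambda>_. x"] that assms q pos dec c K
    unfolding K_def rhs_v_def by (intro mult_bound) auto
  \<comment> \<open>Inserting \<open>v_ge\<close> into \<open>u_ge\<close> yields
    \<open>D * u x powr (q\<^sub>1 * q\<^sub>2) \<le> u x\<close>.\<close>
  define D where "D = c\<^sub>1 * K * (c\<^sub>2 * K) powr q\<^sub>2"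
  have D: "0 < D" using c K by (simp add: D_def)
  \<comment> \<open>\<open>M\<close> is the positive root of
    \<open>D * t powr (q\<^sub>1 * q\<^sub>2) = t\<close>; since
    \<open>q\<^sub>1 * q\<^sub>2 - 1\<close> is positive, the inequality for \<open>u x\<close>
    forces \<open>u x \<le> M\<close>.\<close>
  define M where "M = (1 / D) powr (1 / (q\<^sub>1 * q\<^sub>2 - 1))"
  have u_le: "u x \<le> M" if "x \<noteq> 0" for x
  proof -
    have ux: "0 < u x" using pos that by auto
    have "(c\<^sub>2 * K * u x powr q\<^sub>1) powr q\<^sub>2 \<le> v x powr q\<^sub>2"
      using v_ge[OF that] q c K by (intro powr_mono2) (auto simp: mult.assoc)
    then have "c\<^sub>1 * K * (c\<^sub>2 * K * u x powr q\<^sub>1) powr q\<^sub>2 \<le> c\<^sub>1 * K * v x powr q\<^sub>2"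
      using c K by (intro mult_left_mono) auto
    also have "\<dots> \<le> u x" using u_ge[OF that] by (simp add: mult.assoc)
    finally have "D * u x powr (q\<^sub>1 * q\<^sub>2) \<le> u x"
      using c K by (simp add: D_def powr_mult powr_powr mult.assoc)
    moreover have "u x powr (q\<^sub>1 * q\<^sub>2) = u x powr (q\<^sub>1 * q\<^sub>2 - 1) * u x"
      using ux by (simp add: powr_diff)
    ultimately have "u x powr (q\<^sub>1 * q\<^sub>2 - 1) \<le> 1 / D"
      using ux D by (simp add: field_simps)
    then have "(u x powr (q\<^sub>1 * q\<^sub>2 - 1)) powr (1 / (q\<^sub>1 * q\<^sub>2 - 1)) \<le> M"
      unfolding M_def using assms by (intro powr_mono2) auto
    then show ?thesis using ux assms by (simp add: powr_powr)
  qed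
  obtain e :: "real^'n" where e: "norm e = 1"
    using vector_choose_size[of 1] by auto
  then have "e \<noteq> 0" by auto
  define L where "L = v e powr q\<^sub>2 * unit_ball_vol (real CARD('n)) / 8 ^ CARD('n)"
  have L: "0 < L" using pos(2)[OF \<open>e \<noteq> 0\<close>] by (simp add: L_def)
  \<comment> \<open>With this many annuli the lower bound \<open>c\<^sub>1 * (real N * L)\<close>
    for \<open>u\<close> at distance \<open>(1/2) ^ N\<close> from the origin exceeds
    \<open>M\<close>.\<close>
  obtain N :: nat where N: "M / (c\<^sub>1 * L) < real N" using reals_Archimedean2 by blast
  define x where "x = (1/2::real) ^ N *\<^sub>R e"
  have x: "x \<noteq> 0" "norm x \<le> (1/2) ^ N" using e \<open>e \<noteq> 0\<close> by (auto simp: x_def)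
  have "ennreal (real N * L) \<le> rhs_u \<gamma> q\<^sub>2 v x"
    unfolding L_def using assms q x e pos dec by (intro rhs_u_log_growth) auto
  then have "c\<^sub>1 * (real N * L) \<le> u x"
    using U[OF x(1)] c L pos x by (intro mult_bound) auto
  moreover have "M < c\<^sub>1 * (real N * L)"
    using N c L by (simp add: field_simps)
  ultimately show False using u_le[OF x(1)] by linarith
qed

end
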